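(* For every nonnegative integer $k$, \[ \sum_{C\in\Delta^+_k}\mathrm{wt}_q(C)=\sum_{i=-k}^{k}(-q)^{i^2}, \] where $\Delta^+_k$ is the set of $\delta_k^+$-configurations defined below. Equivalently, for $k\ge1$, $\sum_{C\in\Delta^+_k}\mathrm{wt}_q(C)=\sum_{C\in\Delta^+_{k-1}}\mathrm{wt}_q(C)+2(-q)^{k^2}$.
   Context: Partitions are identified with their Ferrers diagrams (English convention: row $i$ from the top has $\lambda_i$ cells, left-justified). $\delta_k$ denotes the staircase partition $(k,k-1,\dots,1)$ (and $\delta_0=\emptyset$). For partitions $\lambda\subset\mu$, $\mu/\lambda$ is the set of cells of $\mu$ not in $\lambda$. A $\delta_k^+$-configuration is a pair $(\lambda,A)$ where $\lambda$ is a partition with $\lambda\subset\delta_{k-1}$ and $A$ is a set of arrows, each arrow occupying all the cells of one whole row or of one whole column of $\delta_k/\lambda$ (horizontal or vertical arrow; each row or column of $\delta_k/\lambda$ carries at most one arrow), such that no outer corner of $\delta_k/\lambda$ is occupied by two arrows; an outer corner is a cell $c\in\delta_k/\lambda$ such that $\lambda\cup\{c\}$ is a partition. The length of an arrow is the number of cells it occupies, and $\|A\|$ is the sum of the arrow lengths. $\Delta^+_k$ is the set of $\delta_k^+$-configurations, and the $q$-weight of $C=(\lambda,A)$ is $\mathrm{wt}_q(C)=(-1)^{|A|}q^{2|\lambda|+\|A\|}$, where $|\lambda|$ is the number of cells of $\lambda$ and $|A|$ the number of arrows. *)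

theory Defs
  imports Main
begin

definition is_partition :: "nat list \<Rightarrow> bool" where
  "is_partition xs \<longleftrightarrow> sorted_wrt (\<ge>) xs \<and> (\<forall>x \<in> set xs. 0 < x)"

text \<open>The cell \<open>(i, j)\<close> lies in row \<open>i\<close> (from the top) and column \<open>j\<close> (from the left), both
  counted from 0.\<close>

type_synonym cell = "nat \<times> nat"

definition ferrers :: "nat list \<Rightarrow> cell set" where
  "ferrers xs = {(i, j). i < length xs \<and> j < xs ! i}"

text \<open>Partitions are identified with their Ferrers diagrams.\<close>

definition partition_diagrams :: "cell set set" where
  "partition_diagrams = ferrers ` {xs. is_partition xs}"

definition staircase :: "nat \<Rightarrow> cell set" where
  "staircase k = ferrers (rev [1..<k + 1])"

text \<open>In a skew shape \<open>S\<close>, \<open>Horizontal i\<close> is the arrow filling row \<open>i\<close> and \<open>Vertical j\<close> the arrow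
  filling column \<open>j\<close>. The two are distinct arrows even when they fill the same single cell.\<close>

datatype arrow = Horizontal nat | Vertical nat

fun arrow_cells :: "cell set \<Rightarrow> arrow \<Rightarrow> cell set" where
  "arrow_cells S (Horizontal r) = {(i, j) \<in> S. i = r}"
| "arrow_cells S (Vertical c) = {(i, j) \<in> S. j = c}"

definition arrows :: "cell set \<Rightarrow> arrow set" where
  "arrows S = {a. arrow_cells S a \<noteq> {}}"

definition outer_corners :: "nat \<Rightarrow> cell set \<Rightarrow> cell set" where
  "outer_corners k L = {c \<in> staircase k - L. insert c L \<in> partition_diagrams}"

text \<open>For \<open>k = 0\<close>, truncated subtraction reads \<open>staircase (k - 1)\<close> as the empty diagram, so that the
  only configuration is \<open>({}, {})\<close>.\<close>

definition staircase_configs :: "nat \<Rightarrow> (cell set \<times> arrow set) set" where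
  "staircase_configs k =
    {(L, A). L \<in> partition_diagrams \<and> L \<subseteq> staircase (k - 1) \<and>
       A \<subseteq> arrows (staircase k - L) \<and>
       (\<forall>c \<in> outer_corners k L. \<forall>a \<in> A. \<forall>b \<in> A.
          c \<in> arrow_cells (staircase k - L) a \<and> c \<in> arrow_cells (staircase k - L) b \<longrightarrow> a = b)}"

definition total_length :: "cell set \<Rightarrow> arrow set \<Rightarrow> nat" where
  "total_length S A = (\<Sum>a\<in>A. card (arrow_cells S a))"

fun wt :: "nat \<Rightarrow> 'a::comm_ring_1 \<Rightarrow> cell set \<times> arrow set \<Rightarrow> 'a" where
  "wt k q (L, A) = (-1) ^ card A * q ^ (2 * card L + total_length (staircase k - L) A)"

text \<open>Sums over \<open>staircase_configs k\<close> are genuine finite sums.\<close>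

lemma finite_ferrers: "finite (ferrers xs)"
proof -
  have "ferrers xs \<subseteq> (SIGMA i:{..<length xs}. {..<xs ! i})"
    by (auto simp: ferrers_def)
  then show ?thesis
    by (rule finite_subset) auto
qed

lemma finite_staircase_configs: "finite (staircase_configs k)"
proof -
  let ?S = "staircase k"
  have fin: "finite (staircase n)" for n
    by (simp add: staircase_def finite_ferrers)
  let ?B = "Horizontal ` fst ` ?S \<union> Vertical ` snd ` ?S"
  have "arrows (?S - L) \<subseteq> ?B" for L
  proof
    fix a assume "a \<in> arrows (?S - L)"
    then show "a \<in> ?B"
      by (cases a) (force simp: arrows_def)+
  qed
  then have "staircase_configs k \<subseteq> Pow (staircase (k - 1)) \<times> Pow ?B"
    unfolding staircase_configs_def by blast
  then show ?thesis
    by (rule finite_subset) (simp add: fin)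
qed

end

theory Submission
  imports Defs
begin

text \<open>
  Read the boundary of a partition from the bottom-left corner of the staircase, as a path of \<open>a\<close> up
  steps (rows) and \<open>b\<close> right steps (columns). Restricting to \<open>a\<close> rows and \<open>b\<close> columns gives sums
  \<open>X a b\<close>, and removing the last step of the path gives
  \<open>X a b = q^(2b) (1 - q^(a-b)) X (a-1) b + (1 - q^(a-b+1)) X a (b-1) - q^(2a) X (a-1) (b-1)\<close>,
  where the last term corrects for the forbidden pair of arrows at an outer corner (both arrows
  through a corner have the same length). From this recurrence one proves by induction a second one,
  \<open>X a b = (1 - q^(a+b)) X (a-1) b + q^(a-b) X (a-1) (b-1)\<close> for \<open>a > b > 0\<close>, and the two together
  give \<open>X b b = X (b-1) (b-1) + 2 (-q)^(b^2)\<close> on the diagonal.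
\<close>

section \<open>The recurrences\<close>

text \<open>Here \<open>Z h b\<close> stands for \<open>X (b + h) b\<close>. Each identity is exhibited as an explicit combination
  of known ones.\<close>

lemmas diff_eq_zeroI = right_minus_eq[THEN iffD2]

text \<open>Outer induction on \<open>b\<close>, inner induction on \<open>h\<close>. With
  \<open>q ^ h\<close> and \<open>q ^ b\<close> abbreviated to \<open>u\<close> and
  \<open>v\<close>, each step is a polynomial identity: the difference of the two sides is a
  combination, without division, of differences known to vanish. The cases \<open>h = 0\<close> are
  the inner steps formally evaluated at \<open>h = -1\<close>: there \<open>step\<close> becomes
  \<open>step0\<close>, and the cofactor of the inner hypothesis, a multiple of
  \<open>1 - q ^ (h + 1)\<close>, vanishes.\<close>

lemma off_diagonal_recurrence:
  fixes Z :: "nat \<Rightarrow> nat \<Rightarrow> 'a::comm_ring_1"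
  assumes base: "\<And>h. Z (Suc h) 0 = (1 - q ^ Suc h) * Z h 0"
    and step0: "\<And>b. Z 0 (Suc b) = (1 - q) * Z 1 b - q ^ (2 * Suc b) * Z 0 b"
    and step: "\<And>h b. Z (Suc h) (Suc b) =
      q ^ (2 * Suc b) * (1 - q ^ Suc h) * Z h (Suc b) + (1 - q ^ (h + 2)) * Z (h + 2) b
      - q ^ (2 * (b + h + 2)) * Z (Suc h) b"
  shows "Z (Suc h) (Suc b) = (1 - q ^ (2 * b + h + 3)) * Z h (Suc b) + q ^ Suc h * Z (Suc h) b"
proof (induction b arbitrary: h)
  case 0
  show ?case
  proof (induction h)
    case 0
    have b1: "Z 2 0 = (1 - q ^ 2) * Z 1 0" and b2: "Z 1 0 = (1 - q) * Z 0 0"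
      using base[of 1] base[of 0] by (simp_all add: numeral_2_eq_2)
    have s1: "Z 1 1 = q ^ 2 * (1 - q) * Z 0 1 + (1 - q ^ 2) * Z 2 0 - q ^ 4 * Z 1 0"
      using step[of 0 0] by (simp add: eval_nat_numeral)
    have s2: "Z 0 1 = (1 - q) * Z 1 0 - q ^ 2 * Z 0 0"
      using step0[of 0] by (simp add: eval_nat_numeral)
    have "Z 1 1 - ((1 - q ^ 3) * Z 0 1 + q * Z 1 0) =
        (Z 1 1 - (q ^ 2 * (1 - q) * Z 0 1 + (1 - q ^ 2) * Z 2 0 - q ^ 4 * Z 1 0))
        + (1 - q ^ 2) * (Z 2 0 - ((1 - q ^ 2) * Z 1 0))
        + (- (q ^ 2 + q ^ 3)) * (Z 1 0 - ((1 - q) * Z 0 0))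
        + (- (1 - q ^ 2)) * (Z 0 1 - ((1 - q) * Z 1 0 - q ^ 2 * Z 0 0))"
      by (simp add: eval_nat_numeral algebra_simps)
    then have "Z 1 1 = (1 - q ^ 3) * Z 0 1 + q * Z 1 0"
      by (simp only: diff_eq_zeroI[OF s1] diff_eq_zeroI[OF b1] diff_eq_zeroI[OF b2]
        diff_eq_zeroI[OF s2] mult_zero_right add_0_left right_minus_eq)
    then show ?case
      by simp
  next
    case (Suc h)
    define u where "u = q ^ h"
    \<comment> \<open>For the first column the values \<open>Z _ 0\<close> are reduced by
      \<open>base\<close>, which stands in for the outer hypothesis.\<close>
    have b1: "Z (h + 3) 0 = (1 - q * q * q * u) * Z (h + 2) 0"
      using base[of "h + 2"] by (simp add: u_def numeral_3_eq_3 algebra_simps)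
    have b2: "Z (h + 2) 0 = (1 - q * q * u) * Z (h + 1) 0"
      using base[of "h + 1"] by (simp add: u_def algebra_simps)
    have s1: "Z (h + 2) 1 = q * q * (1 - q * q * u) * Z (h + 1) 1
      + (1 - q * q * q * u) * Z (h + 3) 0
        - q ^ 6 * u ^ 2 * Z (h + 2) 0"
      using step[of "h + 1" 0]
      by (simp add: u_def numeral_3_eq_3 eval_nat_numeral power_add power_mult algebra_simps)
    have s2: "Z (h + 1) 1 = q * q * (1 - q * u) * Z h 1 + (1 - q * q * u) * Z (h + 2) 0
        - q ^ 4 * u ^ 2 * Z (h + 1) 0"
      using step[of h 0]
      by (simp add: u_def numeral_3_eq_3 eval_nat_numeral power_add power_mult algebra_simps)
    have ih: "Z (h + 1) 1 = (1 - q ^ 3 * u) * Z h 1 + q * u * Z (h + 1) 0"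
      using Suc by (simp add: u_def power_add algebra_simps)
    have "Z (h + 2) 1 - ((1 - q ^ 4 * u) * Z (h + 1) 1 + q * q * u * Z (h + 2) 0) =
        (Z (h + 2) 1 - (q * q * (1 - q * q * u) * Z (h + 1) 1 + (1 - q * q * q * u) * Z (h + 3) 0
          - q ^ 6 * u ^ 2 * Z (h + 2) 0))
        + (1 - q ^ 3 * u) * (Z (h + 3) 0 - ((1 - q * q * q * u) * Z (h + 2) 0))
        + (- (q ^ 3 * u + q ^ 5 * u ^ 2)) * (Z (h + 2) 0 - ((1 - q * q * u) * Z (h + 1) 0))
        + (- (1 - q ^ 3 * u)) * (Z (h + 1) 1
          - (q * q * (1 - q * u) * Z h 1 + (1 - q * q * u) * Z (h + 2) 0
            - q ^ 4 * u ^ 2 * Z (h + 1) 0))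
        + (q ^ 2 * (1 - q * u)) * (Z (h + 1) 1 - ((1 - q ^ 3 * u) * Z h 1 + q * u * Z (h + 1) 0))"
      by (simp add: eval_nat_numeral algebra_simps)
    then have "Z (h + 2) 1 = (1 - q ^ 4 * u) * Z (h + 1) 1 + q * q * u * Z (h + 2) 0"
      by (simp only: diff_eq_zeroI[OF s1] diff_eq_zeroI[OF b1] diff_eq_zeroI[OF b2]
        diff_eq_zeroI[OF s2] diff_eq_zeroI[OF ih] mult_zero_right add_0_left right_minus_eq)
    then show ?case by (simp add: u_def eval_nat_numeral algebra_simps)
  qed
next
  case (Suc b)
  note outer = Suc
  define v where "v = q ^ b"
  show ?case
  proof (induction h)
    case 0
    have s1: "Z 1 (b + 2) = q ^ 4 * v ^ 2 * (1 - q) * Z 0 (b + 2) + (1 - q ^ 2) * Z 2 (b + 1)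
        - q ^ 6 * v ^ 2 * Z 1 (b + 1)"
      using step[of 0 "b + 1"]
      by (simp add: v_def eval_nat_numeral power_add power_mult algebra_simps)
    have s2: "Z 1 (b + 1) = q ^ 2 * v ^ 2 * (1 - q) * Z 0 (b + 1) + (1 - q ^ 2) * Z 2 b
        - q ^ 4 * v ^ 2 * Z 1 b"
      using step[of 0 b]
      by (simp add: v_def eval_nat_numeral power_add power_mult algebra_simps)
    have s3: "Z 0 (b + 2) = (1 - q) * Z 1 (b + 1) - q ^ 4 * v ^ 2 * Z 0 (b + 1)"
      using step0[of "b + 1"]
      by (simp add: v_def eval_nat_numeral power_add power_mult algebra_simps)
    have i1: "Z 2 (b + 1) = (1 - q ^ 4 * v ^ 2) * Z 1 (b + 1) + q ^ 2 * Z 2 b"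
      using outer[of 1] by (simp add: v_def eval_nat_numeral power_add power_mult algebra_simps)
    have i2: "Z 1 (b + 1) = (1 - q ^ 3 * v ^ 2) * Z 0 (b + 1) + q * Z 1 b"
      using outer[of 0] by (simp add: v_def eval_nat_numeral power_add power_mult algebra_simps)
    have "Z 1 (b + 2) - ((1 - q ^ 5 * v ^ 2) * Z 0 (b + 2) + q * Z 1 (b + 1)) =
        (Z 1 (b + 2) - (q ^ 4 * v ^ 2 * (1 - q) * Z 0 (b + 2) + (1 - q ^ 2) * Z 2 (b + 1)
          - q ^ 6 * v ^ 2 * Z 1 (b + 1)))
        + (1 - q ^ 2) * (Z 2 (b + 1) - ((1 - q ^ 4 * v ^ 2) * Z 1 (b + 1) + q ^ 2 * Z 2 b))
        + (- (q ^ 2)) * (Z 1 (b + 1)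
          - (q ^ 2 * v ^ 2 * (1 - q) * Z 0 (b + 1) + (1 - q ^ 2) * Z 2 b - q ^ 4 * v ^ 2 * Z 1 b))
        + (- (q ^ 5 * v ^ 2)) * (Z 1 (b + 1) - ((1 - q ^ 3 * v ^ 2) * Z 0 (b + 1) + q * Z 1 b))
        + (- (1 - q ^ 4 * v ^ 2)) * (Z 0 (b + 2)
          - ((1 - q) * Z 1 (b + 1) - q ^ 4 * v ^ 2 * Z 0 (b + 1)))"
      by (simp add: eval_nat_numeral algebra_simps)
    then have "Z 1 (b + 2) = (1 - q ^ 5 * v ^ 2) * Z 0 (b + 2) + q * Z 1 (b + 1)"
      by (simp only: diff_eq_zeroI[OF s1] diff_eq_zeroI[OF i1] diff_eq_zeroI[OF s2]
        diff_eq_zeroI[OF i2] diff_eq_zeroI[OF s3] mult_zero_right add_0_left right_minus_eq)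
    then show ?case by (simp add: v_def eval_nat_numeral power_add power_mult algebra_simps)
  next
    case (Suc h)
    define u where "u = q ^ h"
    have s1: "Z (h + 2) (b + 2) = q ^ 4 * v ^ 2 * (1 - q ^ 2 * u) * Z (h + 1) (b + 2)
        + (1 - q ^ 3 * u) * Z (h + 3) (b + 1) - q ^ 8 * v ^ 2 * u ^ 2 * Z (h + 2) (b + 1)"
      using step[of "h + 1" "b + 1"]
      by (simp add: u_def v_def eval_nat_numeral power_add power_mult algebra_simps)
    have s2: "Z (h + 2) (b + 1) = q ^ 2 * v ^ 2 * (1 - q ^ 2 * u) * Z (h + 1) (b + 1)
        + (1 - q ^ 3 * u) * Z (h + 3) b - q ^ 6 * v ^ 2 * u ^ 2 * Z (h + 2) b"
      using step[of "h + 1" b]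
      by (simp add: u_def v_def eval_nat_numeral power_add power_mult algebra_simps)
    have s3: "Z (h + 1) (b + 2) = q ^ 4 * v ^ 2 * (1 - q * u) * Z h (b + 2)
        + (1 - q ^ 2 * u) * Z (h + 2) (b + 1) - q ^ 6 * v ^ 2 * u ^ 2 * Z (h + 1) (b + 1)"
      using step[of h "b + 1"]
      by (simp add: u_def v_def eval_nat_numeral power_add power_mult algebra_simps)
    have i1: "Z (h + 3) (b + 1) = (1 - q ^ 5 * v ^ 2 * u) * Z (h + 2) (b + 1)
      + q ^ 3 * u * Z (h + 3) b"
      using outer[of "h + 2"]
      by (simp add: u_def v_def eval_nat_numeral power_add power_mult algebra_simps)
    have i2: "Z (h + 2) (b + 1) = (1 - q ^ 4 * v ^ 2 * u) * Z (h + 1) (b + 1)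
      + q ^ 2 * u * Z (h + 2) b"
      using outer[of "h + 1"]
      by (simp add: u_def v_def eval_nat_numeral power_add power_mult algebra_simps)
    have i3: "Z (h + 1) (b + 2) = (1 - q ^ 5 * v ^ 2 * u) * Z h (b + 2) + q * u * Z (h + 1) (b + 1)"
      using Suc by (simp add: u_def v_def eval_nat_numeral power_add power_mult algebra_simps)
    \<comment> \<open>\<open>s1\<close> expands the leading term and \<open>i1\<close> replaces
      \<open>Z (h + 3) (b + 1)\<close>. The other cofactors follow: \<open>s2\<close> removes
      \<open>Z (h + 3) b\<close>, \<open>i2\<close> then removes \<open>Z (h + 2) b\<close>, and
      \<open>s3\<close> and \<open>i3\<close>, two expressions for \<open>Z (h + 1) (b + 2)\<close>,
      are weighted so that \<open>Z h (b + 2)\<close> cancels.\<close>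
    have "Z (h + 2) (b + 2)
      - ((1 - q ^ 6 * v ^ 2 * u) * Z (h + 1) (b + 2) + q ^ 2 * u * Z (h + 2) (b + 1)) =
        (Z (h + 2) (b + 2) - (q ^ 4 * v ^ 2 * (1 - q ^ 2 * u) * Z (h + 1) (b + 2)
          + (1 - q ^ 3 * u) * Z (h + 3) (b + 1) - q ^ 8 * v ^ 2 * u ^ 2 * Z (h + 2) (b + 1)))
        + (1 - q ^ 3 * u) * (Z (h + 3) (b + 1)
          - ((1 - q ^ 5 * v ^ 2 * u) * Z (h + 2) (b + 1) + q ^ 3 * u * Z (h + 3) b))
        + (- (q ^ 3 * u)) * (Z (h + 2) (b + 1)
          - (q ^ 2 * v ^ 2 * (1 - q ^ 2 * u) * Z (h + 1) (b + 1) + (1 - q ^ 3 * u) * Z (h + 3) b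
            - q ^ 6 * v ^ 2 * u ^ 2 * Z (h + 2) b))
        + (- (q ^ 7 * v ^ 2 * u ^ 2)) * (Z (h + 2) (b + 1)
          - ((1 - q ^ 4 * v ^ 2 * u) * Z (h + 1) (b + 1) + q ^ 2 * u * Z (h + 2) b))
        + (- (1 - q ^ 5 * v ^ 2 * u)) * (Z (h + 1) (b + 2)
          - (q ^ 4 * v ^ 2 * (1 - q * u) * Z h (b + 2) + (1 - q ^ 2 * u) * Z (h + 2) (b + 1)
            - q ^ 6 * v ^ 2 * u ^ 2 * Z (h + 1) (b + 1)))
        + (q ^ 4 * v ^ 2 * (1 - q * u)) * (Z (h + 1) (b + 2)
          - ((1 - q ^ 5 * v ^ 2 * u) * Z h (b + 2) + q * u * Z (h + 1) (b + 1)))"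
      by (simp add: eval_nat_numeral algebra_simps)
    then have "Z (h + 2) (b + 2) = (1 - q ^ 6 * v ^ 2 * u) * Z (h + 1) (b + 2)
      + q ^ 2 * u * Z (h + 2) (b + 1)"
      by (simp only: diff_eq_zeroI[OF s1] diff_eq_zeroI[OF i1] diff_eq_zeroI[OF s2]
        diff_eq_zeroI[OF i2] diff_eq_zeroI[OF s3] diff_eq_zeroI[OF i3]
          mult_zero_right add_0_left right_minus_eq)
    then show ?case
      by (simp add: u_def v_def eval_nat_numeral power_add power_mult algebra_simps)
  qed
qed

text \<open>Expanding \<open>Z 0 (b + 2)\<close> by \<open>step0\<close>, replacing
  \<open>Z 1 (b + 1)\<close> by the off-diagonal recurrence and eliminating \<open>Z 1 b\<close> by
  \<open>step0\<close> again shows that each increment along the diagonal is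
  \<open>- (q ^ (2 * b + 3))\<close> times the previous one. The powers
  \<open>(- q) ^ (Suc b) ^ 2\<close> grow by the same factor because consecutive squares differ by
  the odd number \<open>2 * b + 3\<close>.\<close>

lemma diagonal_recurrence:
  fixes Z :: "nat \<Rightarrow> nat \<Rightarrow> 'a::comm_ring_1"
  assumes init: "Z 0 0 = 1"
    and base: "\<And>h. Z (Suc h) 0 = (1 - q ^ Suc h) * Z h 0"
    and step0: "\<And>b. Z 0 (Suc b) = (1 - q) * Z 1 b - q ^ (2 * Suc b) * Z 0 b"
    and step: "\<And>h b. Z (Suc h) (Suc b) =
      q ^ (2 * Suc b) * (1 - q ^ Suc h) * Z h (Suc b) + (1 - q ^ (h + 2)) * Z (h + 2) b
      - q ^ (2 * (b + h + 2)) * Z (Suc h) b"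
  shows "Z 0 (Suc b) = Z 0 b + 2 * (- q) ^ (Suc b) ^ 2"
proof (induction b)
  case 0
  show ?case using step0[of 0] base[of 0] init
    by (simp add: eval_nat_numeral algebra_simps)
next
  case (Suc b)
  define v where "v = q ^ b"
  define c where "c = (- q) ^ (Suc b) ^ 2"
  have s1: "Z 0 (b + 2) = (1 - q) * Z 1 (b + 1) - q ^ 4 * v ^ 2 * Z 0 (b + 1)"
    using step0[of "b + 1"]
    by (simp add: v_def eval_nat_numeral power_add power_mult algebra_simps)
  have s2: "Z 0 (b + 1) = (1 - q) * Z 1 b - q ^ 2 * v ^ 2 * Z 0 b"
    using step0[of b]
    by (simp add: v_def eval_nat_numeral power_add power_mult algebra_simps)
  have i1: "Z 1 (b + 1) = (1 - q ^ 3 * v ^ 2) * Z 0 (b + 1) + q * Z 1 b"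
    using off_diagonal_recurrence[OF base step0 step, of 0 b]
    by (simp add: v_def eval_nat_numeral power_add power_mult algebra_simps)
  have ih: "Z 0 (b + 1) = Z 0 b + 2 * c"
    using Suc by (simp add: c_def)
  have e: "(Suc (Suc b)) ^ 2 = (Suc b) ^ 2 + (2 * b + 3)"
    by (simp add: power2_eq_square)
  have "(- q) ^ (2 * b + 3) = - (q ^ (2 * b + 3))"
    by (rule power_minus_odd) simp
  also have "q ^ (2 * b + 3) = q ^ 3 * v ^ 2"
    by (simp add: v_def power_add power_even_eq)
  finally have c: "(- q) ^ (Suc (Suc b)) ^ 2 = - (q ^ 3 * v ^ 2) * c"
    by (simp only: e power_add c_def) (simp add: algebra_simps)
  have "Z 0 (b + 2) - (Z 0 (b + 1) - 2 * (q ^ 3 * v ^ 2 * c)) =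
      (Z 0 (b + 2) - ((1 - q) * Z 1 (b + 1) - q ^ 4 * v ^ 2 * Z 0 (b + 1)))
      + (1 - q) * (Z 1 (b + 1) - ((1 - q ^ 3 * v ^ 2) * Z 0 (b + 1) + q * Z 1 b))
      + (- q) * (Z 0 (b + 1) - ((1 - q) * Z 1 b - q ^ 2 * v ^ 2 * Z 0 b))
      + (- (q ^ 3 * v ^ 2)) * (Z 0 (b + 1) - (Z 0 b + 2 * c))"
    by (simp add: eval_nat_numeral algebra_simps)
  then have "Z 0 (b + 2) = Z 0 (b + 1) - 2 * (q ^ 3 * v ^ 2 * c)"
    by (simp only: diff_eq_zeroI[OF s1] diff_eq_zeroI[OF i1] diff_eq_zeroI[OF s2]
      diff_eq_zeroI[OF ih] mult_zero_right add_0_left right_minus_eq)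
  then show ?case unfolding c by (simp add: algebra_simps)
qed

section \<open>Configurations in \<open>a\<close> rows and \<open>b\<close> columns\<close>

definition down_closed :: "cell set \<Rightarrow> bool" where
  "down_closed L \<longleftrightarrow> (\<forall>i j i' j'. (i, j) \<in> L \<longrightarrow> i' \<le> i \<longrightarrow> j' \<le> j \<longrightarrow> (i', j') \<in> L)"

text \<open>A cell that can be added to a diagram, described only by the cells above it and to its
  left, so that no staircase size enters; \<open>outer_corners_iff\<close> is the link to
  \<open>outer_corners\<close>.\<close>

definition corner :: "cell set \<Rightarrow> nat \<Rightarrow> nat \<Rightarrow> bool" where
  "corner L i j \<longleftrightarrow> (i, j) \<notin> L \<and> (\<forall>i'<i. (i', j) \<in> L) \<and> (\<forall>j'<j. (i, j') \<in> L)"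

text \<open>The condition \<open>i + j + 1 < a\<close> is containment in the staircase of size
  \<open>a - 1\<close> without truncated subtraction. The case \<open>b = a\<close> is the one in
  the theorem.\<close>

definition subdiagrams :: "nat \<Rightarrow> nat \<Rightarrow> cell set set" where
  "subdiagrams a b = {L. down_closed L \<and> (\<forall>(i, j)\<in>L. i + j + 1 < a \<and> j < b)}"

text \<open>Arrows are encoded by row and column index alone. Only \<open>Horizontal i\<close> and
  \<open>Vertical j\<close> pass through the cell \<open>(i, j)\<close>, so the condition at a
  corner excludes just this pair. Columns from \<open>b\<close> on carry no arrow, so a corner there
  imposes nothing.\<close>

definition admissible :: "nat \<Rightarrow> nat \<Rightarrow> cell set \<Rightarrow> arrow set set" where
  "admissible a b L = {A. A \<subseteq> Horizontal ` {..<a} \<union> Vertical ` {..<b} \<and>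
     (\<forall>i j. corner L i j \<longrightarrow> \<not> (Horizontal i \<in> A \<and> Vertical j \<in> A))}"

text \<open>Rows have their full length in \<open>staircase a\<close>; they are not cut off at column \<open>b\<close>.\<close>

definition arrow_length :: "nat \<Rightarrow> cell set \<Rightarrow> arrow \<Rightarrow> nat" where
  "arrow_length a L x = card (arrow_cells (staircase a - L) x)"

text \<open>The signed generating function of the arrow sets for a fixed diagram, in product form so
  that an extra arrow contributes a factor.\<close>

definition arrow_sum :: "'a::comm_ring_1 \<Rightarrow> nat \<Rightarrow> nat \<Rightarrow> cell set \<Rightarrow> 'a" where
  "arrow_sum q a b L = (\<Sum>A\<in>admissible a b L. \<Prod>x\<in>A. - (q ^ arrow_length a L x))"

text \<open>This is the sum \<open>X a b\<close> of the recurrences.\<close>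

definition config_sum :: "'a::comm_ring_1 \<Rightarrow> nat \<Rightarrow> nat \<Rightarrow> 'a" where
  "config_sum q a b = (\<Sum>L\<in>subdiagrams a b. q ^ (2 * card L) * arrow_sum q a b L)"

text \<open>Inverse to deleting a final up step of the boundary path: the partition receives a new
  first part \<open>b\<close>.\<close>

definition add_row :: "nat \<Rightarrow> cell set \<Rightarrow> cell set" where
  "add_row b L = {0} \<times> {..<b} \<union> map_prod Suc id ` L"

fun shift_arrow :: "arrow \<Rightarrow> arrow" where
  "shift_arrow (Horizontal i) = Horizontal (Suc i)"
| "shift_arrow (Vertical j) = Vertical j"

lemma mem_staircase [simp]: "(i, j) \<in> staircase k \<longleftrightarrow> i + j < k"
  by (auto simp: staircase_def ferrers_def rev_nth simp del: upt_Suc)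

lemma finite_staircase: "finite (staircase k)"
  by (simp add: staircase_def finite_ferrers)

lemma subdiagramsD:
  assumes "L \<in> subdiagrams a b" "(i, j) \<in> L"
  shows "i + j + 1 < a" "j < b"
  using assms by (auto simp: subdiagrams_def)

lemma subdiagrams_downD:
  "L \<in> subdiagrams a b \<Longrightarrow> (i, j) \<in> L \<Longrightarrow> i' \<le> i \<Longrightarrow> j' \<le> j \<Longrightarrow> (i', j') \<in> L"
  unfolding subdiagrams_def down_closed_def by blast

lemma subdiagramsI:
  assumes "\<And>i j. (i, j) \<in> L \<Longrightarrow> i + j + 1 < a" "\<And>i j. (i, j) \<in> L \<Longrightarrow> j < b"
    and "\<And>i j i' j'. (i, j) \<in> L \<Longrightarrow> i' \<le> i \<Longrightarrow> j' \<le> j \<Longrightarrow> (i', j') \<in> L"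
  shows "L \<in> subdiagrams a b"
  unfolding subdiagrams_def down_closed_def using assms by blast

lemma subdiagrams_subset: "L \<in> subdiagrams a b \<Longrightarrow> L \<subseteq> staircase a"
  by (rule subrelI) (auto dest: subdiagramsD(1))

lemma finite_subdiagrams: "finite (subdiagrams a b)"
  by (rule finite_subset[of _ "Pow (staircase a)"])
    (simp_all add: finite_staircase subsetI subdiagrams_subset)

lemma finite_subdiagram: "L \<in> subdiagrams a b \<Longrightarrow> finite L"
  by (rule finite_subset[OF subdiagrams_subset finite_staircase])

lemma finite_admissible: "finite (admissible a b L)"
  by (rule finite_subset[of _ "Pow (Horizontal ` {..<a} \<union> Vertical ` {..<b})"])
    (auto simp: admissible_def)

lemma admissible_imp_finite: "A \<in> admissible a b L \<Longrightarrow> finite A"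
  by (rule finite_subset[of _ "Horizontal ` {..<a} \<union> Vertical ` {..<b}"])
    (auto simp: admissible_def)

section \<open>Diagrams with a prepended top row\<close>

lemma mem_add_row [simp]:
  "(0, j) \<in> add_row b L \<longleftrightarrow> j < b"
  "(Suc i, j) \<in> add_row b L \<longleftrightarrow> (i, j) \<in> L"
  by (force simp: add_row_def)+

lemma inj_map_prod_Suc: "inj_on (map_prod Suc id) S"
  by (auto simp: inj_on_def)

lemma inj_add_row: "inj (add_row b)"
proof (rule injI)
  fix L M assume "add_row b L = add_row b M"
  then have "(Suc i, j) \<in> add_row b L \<longleftrightarrow> (Suc i, j) \<in> add_row b M" for i j
    by simp
  then show "L = M" by auto
qed

lemma card_add_row: "finite L \<Longrightarrow> card (add_row b L) = b + card L"
  unfolding add_row_def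
  by (subst card_Un_disjoint) (auto simp: card_image inj_map_prod_Suc)

text \<open>Deleting the top row is the inverse map. The bound \<open>b \<le> a\<close> makes the
  new top row, whose last cell is in column \<open>b - 1\<close>, fit into the staircase of size
  \<open>a\<close> that bounds \<open>subdiagrams (Suc a) b\<close>.\<close>

lemma add_row_subdiagrams:
  assumes "b \<le> a"
  shows "add_row b ` subdiagrams a b = {L \<in> subdiagrams (Suc a) b. \<forall>j<b. (0, j) \<in> L}" (is "?l = ?r")
proof (intro equalityI subsetI)
  fix M assume "M \<in> ?l"
  then obtain L where L: "L \<in> subdiagrams a b" and M: "M = add_row b L" by blast
  have "M \<in> subdiagrams (Suc a) b"
  proof (rule subdiagramsI)
    fix i j assume ij: "(i, j) \<in> M"
    show "i + j + 1 < Suc a" "j < b"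
      using ij assms subdiagramsD[OF L, of "i - 1" j] unfolding M by (cases i; simp)+
    fix i' j' assume "i' \<le> i" "j' \<le> j"
    then show "(i', j') \<in> M"
      using ij \<open>j < b\<close> subdiagrams_downD[OF L, of "i - 1" j "i' - 1" j']
      unfolding M by (cases i; cases i'; simp)
  qed
  then show "M \<in> ?r"
    by (simp add: M)
next
  fix M assume M: "M \<in> ?r"
  define L where "L = {(i, j). (Suc i, j) \<in> M}"
  from M have M': "M \<in> subdiagrams (Suc a) b" and top: "\<And>j. j < b \<Longrightarrow> (0, j) \<in> M" by blast+
  have "(i, j) \<in> M \<longleftrightarrow> (i, j) \<in> add_row b L" for i j
    using subdiagramsD(2)[OF M', of 0 j] top[of j] by (cases i) (auto simp: L_def)
  then have eq: "M = add_row b L" by auto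
  have "L \<in> subdiagrams a b"
  proof (rule subdiagramsI)
    fix i j assume "(i, j) \<in> L"
    then have ij: "(Suc i, j) \<in> M" by (simp add: L_def)
    show "i + j + 1 < a" "j < b"
      using subdiagramsD[OF M' ij] by simp_all
    fix i' j' assume "i' \<le> i" "j' \<le> j"
    then show "(i', j') \<in> L"
      using subdiagrams_downD[OF M' ij, of "Suc i'" j'] by (simp add: L_def)
  qed
  with eq show "M \<in> ?l" by blast
qed

section \<open>Arrow lengths and admissible arrow sets\<close>

lemma arrow_length_Vertical_empty:
  assumes "L \<in> subdiagrams a b"
  shows "arrow_length a L (Vertical b) = a - b"
proof -
  \<comment> \<open>\<open>L\<close> has no cell in column \<open>b\<close>, so the arrow runs
    through the whole column of the staircase.\<close>
  have "arrow_cells (staircase a - L) (Vertical b) = (\<lambda>i. (i, b)) ` {..<a - b}"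
    using subdiagramsD(2)[OF assms] by (auto simp: image_iff)
  then show ?thesis
    by (simp add: arrow_length_def card_image inj_on_def)
qed

lemma arrow_length_add_row_top:
  "arrow_length (Suc a) (add_row b L) (Horizontal 0) = Suc a - b"
proof -
  have "arrow_cells (staircase (Suc a) - add_row b L) (Horizontal 0) = Pair 0 ` {b..<Suc a}"
    by auto
  then show ?thesis
    by (simp add: arrow_length_def card_image inj_on_def)
qed

text \<open>Rows move down by one while the staircase grows by one, so row lengths persist. A column
  \<open>j < b\<close> acquires the cell \<open>(0, j)\<close>, but that cell lies in the new
  diagram; this is why only columns below \<open>b\<close> are allowed.\<close>

lemma arrow_length_add_row:
  assumes "x \<in> Horizontal ` {..<a} \<union> Vertical ` {..<b}"
  shows "arrow_length (Suc a) (add_row b L) (shift_arrow x) = arrow_length a L x"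
proof -
  have "(i, j) \<in> arrow_cells (staircase (Suc a) - add_row b L) (shift_arrow x) \<longleftrightarrow>
    (i, j) \<in> map_prod Suc id ` arrow_cells (staircase a - L) x" for i j
    using assms by (cases i; cases x) (auto simp: image_iff)
  then have "arrow_cells (staircase (Suc a) - add_row b L) (shift_arrow x) =
      map_prod Suc id ` arrow_cells (staircase a - L) x"
    by auto
  then show ?thesis
    by (simp add: arrow_length_def card_image inj_map_prod_Suc)
qed

lemma corner_add_row:
  assumes "j < b"
  shows "corner (add_row b L) i j \<longleftrightarrow> (\<exists>i'. i = Suc i' \<and> corner L i' j)"
  using assms by (cases i) (auto simp: corner_def All_less_Suc2)

lemma inj_shift_arrow: "inj shift_arrow"
proof (rule injI)
  show "x = y" if "shift_arrow x = shift_arrow y" for x y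
    using that by (cases x; cases y) auto
qed

lemma shift_arrow_eq_iff [simp]:
  "shift_arrow x = Horizontal (Suc i) \<longleftrightarrow> x = Horizontal i"
  "shift_arrow x = Vertical j \<longleftrightarrow> x = Vertical j"
  "shift_arrow x \<noteq> Horizontal 0"
  "Horizontal 0 \<noteq> shift_arrow x"
  by (cases x; auto)+

lemma mem_shift_arrow_image [simp]:
  "Horizontal (Suc i) \<in> shift_arrow ` A \<longleftrightarrow> Horizontal i \<in> A"
  "Vertical j \<in> shift_arrow ` A \<longleftrightarrow> Vertical j \<in> A"
  "Horizontal 0 \<notin> shift_arrow ` A"
  by (auto simp: image_iff eq_commute[of _ "shift_arrow _"])

text \<open>Every arrow other than \<open>Horizontal 0\<close> is a shifted arrow, and by
  \<open>corner_add_row\<close> the corner conditions in columns below \<open>b\<close> correspond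
  under the shift. All vertical arrows lie in these columns.\<close>

lemma admissible_add_row_without_top:
  "{A \<in> admissible (Suc a) b (add_row b L). Horizontal 0 \<notin> A} = (`) shift_arrow ` admissible a b L"
  (is "?l = ?r")
proof (intro equalityI subsetI)
  fix A assume A: "A \<in> ?l"
  define B where "B = shift_arrow -` A"
  have "x \<in> range shift_arrow" if "x \<in> A" for x
  proof (cases x)
    case (Horizontal i)
    with that A obtain i' where "i = Suc i'" by (cases i) auto
    then show ?thesis using Horizontal by (auto intro: range_eqI[of _ _ "Horizontal i'"])
  qed (auto intro: range_eqI[of _ _ "Vertical _"])
  then have AB: "A = shift_arrow ` B" unfolding B_def by auto
  have "B \<in> admissible a b L"
    unfolding admissible_def mem_Collect_eq
  proof (intro conjI allI impI subsetI)
    fix x assume "x \<in> B"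
    then have "shift_arrow x \<in> A" by (simp add: B_def)
    then show "x \<in> Horizontal ` {..<a} \<union> Vertical ` {..<b}"
      using A by (cases x) (auto simp: admissible_def)
  next
    fix i j assume c: "corner L i j"
    show "\<not> (Horizontal i \<in> B \<and> Vertical j \<in> B)"
    proof
      assume "Horizontal i \<in> B \<and> Vertical j \<in> B"
      then have h: "Horizontal (Suc i) \<in> A" and v: "Vertical j \<in> A" by (auto simp: B_def)
      from v A have "j < b" by (auto simp: admissible_def)
      with c have "corner (add_row b L) (Suc i) j" by (simp add: corner_add_row)
      with A h v show False by (auto simp: admissible_def)
    qed
  qed
  with AB show "A \<in> ?r" by blast
next
  fix A assume "A \<in> ?r"
  then obtain B where B: "B \<in> admissible a b L" and A: "A = shift_arrow ` B" by blast
  have sub: "B \<subseteq> Horizontal ` {..<a} \<union> Vertical ` {..<b}" using B by (simp add: admissible_def)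
  have "A \<subseteq> Horizontal ` {..<Suc a} \<union> Vertical ` {..<b}"
    using sub unfolding A by auto
  moreover have "\<not> (Horizontal i \<in> A \<and> Vertical j \<in> A)" if c: "corner (add_row b L) i j" for i j
  proof
    assume HV: "Horizontal i \<in> A \<and> Vertical j \<in> A"
    then have "j < b" using sub by (auto simp: A)
    with c obtain i' where "i = Suc i'" "corner L i' j" by (auto simp: corner_add_row)
    with HV B show False by (auto simp: A admissible_def)
  qed
  ultimately show "A \<in> ?l" by (auto simp: admissible_def A)
qed

text \<open>The corner of the top row is \<open>(0, b)\<close>, just beyond the columns that carry
  arrows, so it forbids nothing and \<open>Horizontal 0\<close> can be added freely.\<close>

lemma admissible_add_row:
  "admissible (Suc a) b (add_row b L) =
    (`) shift_arrow ` admissible a b L \<union> insert (Horizontal 0) ` (`) shift_arrow ` admissible a b L"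
proof -
  let ?M = "admissible (Suc a) b (add_row b L)"
  have nc: "\<not> corner (add_row b L) 0 j" if "j < b" for j
    using that by (simp add: corner_def)
  have ins: "insert (Horizontal 0) A \<in> ?M \<longleftrightarrow> A \<in> ?M" for A
  proof -
    have "\<not> corner (add_row b L) 0 j" if "Vertical j \<in> A" "A \<subseteq> Horizontal ` {..<Suc a}
      \<union> Vertical ` {..<b}" for j
      using that nc by auto
    then show ?thesis
      by (auto simp: admissible_def)
  qed
  have "A \<in> ?M \<longleftrightarrow> A \<in> {A \<in> ?M. Horizontal 0 \<notin> A}
    \<union> insert (Horizontal 0) ` {A \<in> ?M. Horizontal 0 \<notin> A}" for A
  proof (cases "Horizontal 0 \<in> A")
    case True
    then obtain B where "A = insert (Horizontal 0) B" "Horizontal 0 \<notin> B"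
      by (meson mk_disjoint_insert)
    then show ?thesis
      using ins by (auto simp: insert_ident)
  qed (auto simp: ins)
  then have "?M = {A \<in> ?M. Horizontal 0 \<notin> A} \<union> insert (Horizontal 0) ` {A \<in> ?M. Horizontal 0 \<notin> A}"
    by blast
  then show ?thesis
    by (simp only: admissible_add_row_without_top)
qed

lemma sum_prod_insert:
  fixes w :: "'b \<Rightarrow> 'a::comm_ring_1"
  assumes "finite M" "\<And>A. A \<in> M \<Longrightarrow> finite A \<and> x \<notin> A"
  shows "(\<Sum>A\<in>insert x ` M. \<Prod>y\<in>A. w y) = w x * (\<Sum>A\<in>M. \<Prod>y\<in>A. w y)"
proof -
  have "inj_on (insert x) M"
    using assms(2) by (meson inj_onI insert_ident)
  then show ?thesis
    using assms(2) by (simp add: sum.reindex sum_distrib_left)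
qed

lemma sum_shifted_admissible:
  "(\<Sum>A\<in>(`) shift_arrow ` admissible a b L. \<Prod>x\<in>A. - (q ^ arrow_length (Suc a) (add_row b L) x)) =
    arrow_sum q a b L"
proof -
  have inj: "inj_on ((`) shift_arrow) (admissible a b L)"
    by (meson inj_image_eq_iff inj_onI inj_shift_arrow)
  have "(\<Prod>x\<in>shift_arrow ` A. - (q ^ arrow_length (Suc a) (add_row b L) x)) =
      (\<Prod>x\<in>A. - (q ^ arrow_length a L x))" if "A \<in> admissible a b L" for A
  proof -
    have "A \<subseteq> Horizontal ` {..<a} \<union> Vertical ` {..<b}"
      using that by (simp add: admissible_def)
    then show ?thesis
      by (subst prod.reindex)
        (auto intro!: prod.cong arg_cong[of _ _ "power q"] arrow_length_add_row
          intro: inj_on_subset[OF inj_shift_arrow])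
  qed
  then show ?thesis
    unfolding arrow_sum_def by (simp add: sum.reindex[OF inj])
qed

text \<open>The two terms of the factor correspond to leaving out and including
  \<open>Horizontal 0\<close>, whose length is \<open>Suc a - b\<close>.\<close>

lemma arrow_sum_add_row:
  "arrow_sum q (Suc a) b (add_row b L) = (1 - q ^ (Suc a - b)) * arrow_sum q a b L"
proof -
  let ?M = "(`) shift_arrow ` admissible a b L"
  have "?M \<inter> insert (Horizontal 0) ` ?M = {}"
    using mem_shift_arrow_image(3) by blast
  then have "arrow_sum q (Suc a) b (add_row b L) = arrow_sum q a b L +
      (\<Sum>A\<in>insert (Horizontal 0) ` ?M. \<Prod>x\<in>A. - (q ^ arrow_length (Suc a) (add_row b L) x))"
    unfolding arrow_sum_def[of q "Suc a"] admissible_add_row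
    by (subst sum.union_disjoint) (auto simp: finite_admissible sum_shifted_admissible)
  also have "\<dots> = arrow_sum q a b L - q ^ (Suc a - b) * arrow_sum q a b L"
    by (subst sum_prod_insert)
      (auto simp: finite_admissible admissible_imp_finite sum_shifted_admissible arrow_length_add_row_top)
  finally show ?thesis by (simp add: algebra_simps)
qed

section \<open>Admitting arrows in a column free of diagram cells\<close>

lemma corner_first_empty_column:
  assumes "L \<in> subdiagrams a b"
  shows "corner L i b \<longleftrightarrow> i = 0 \<and> (\<forall>j<b. (0, j) \<in> L)"
proof -
  \<comment> \<open>Column \<open>b\<close> has no cell in \<open>L\<close>, so a corner in a row
    \<open>i > 0\<close> would need the absent cell \<open>(0, b)\<close> above it.\<close>
  have "(i', b) \<notin> L" for i'
    using subdiagramsD(2)[OF assms] by blast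
  then show ?thesis
    by (cases i) (auto simp: corner_def)
qed

text \<open>Split according to whether \<open>Vertical b\<close> is used. If it is, deleting it
  leaves a set admissible for \<open>b\<close> columns; the only new condition comes from the corner
  \<open>(0, b)\<close>, which exists exactly when the top row is full, and then excludes
  \<open>Horizontal 0\<close>.\<close>

lemma arrow_sum_Suc:
  assumes L: "L \<in> subdiagrams a b"
  shows "arrow_sum q a (Suc b) L = arrow_sum q a b L - q ^ (a - b) *
    (\<Sum>A\<in>{A \<in> admissible a b L. \<not> ((\<forall>j<b. (0, j) \<in> L) \<and> Horizontal 0 \<in> A)}.
       \<Prod>x\<in>A. - (q ^ arrow_length a L x))"
proof -
  let ?N = "{A \<in> admissible a b L. \<not> ((\<forall>j<b. (0, j) \<in> L) \<and> Horizontal 0 \<in> A)}"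
  have nv: "Vertical b \<notin> A" if "A \<in> admissible a b L" for A
    using that by (auto simp: admissible_def)
  have "A \<in> admissible a (Suc b) L \<longleftrightarrow> A \<in> admissible a b L \<union> insert (Vertical b) ` ?N" for A
  proof (cases "Vertical b \<in> A")
    case False
    have "A \<subseteq> Horizontal ` {..<a} \<union> Vertical ` {..<Suc b} \<longleftrightarrow>
        A \<subseteq> Horizontal ` {..<a} \<union> Vertical ` {..<b}"
      using False by (auto simp: lessThan_Suc)
    then have "A \<in> admissible a (Suc b) L \<longleftrightarrow> A \<in> admissible a b L"
      by (simp add: admissible_def)
    then show ?thesis using False by auto
  next
    case True
    define B where "B = A - {Vertical b}"
    have A: "A = insert (Vertical b) B" and B: "Vertical b \<notin> B"
      using True by (auto simp: B_def)
    have sub: "A \<subseteq> Horizontal ` {..<a} \<union> Vertical ` {..<Suc b} \<longleftrightarrow>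
        B \<subseteq> Horizontal ` {..<a} \<union> Vertical ` {..<b}"
      using B by (auto simp: A lessThan_Suc)
    have "(\<forall>i j. corner L i j \<longrightarrow> \<not> (Horizontal i \<in> A \<and> Vertical j \<in> A)) \<longleftrightarrow>
        (\<forall>i j. corner L i j \<longrightarrow> \<not> (Horizontal i \<in> B \<and> Vertical j \<in> B)) \<and>
        (\<forall>i. corner L i b \<longrightarrow> Horizontal i \<notin> B)"
      unfolding A by auto
    moreover have "(\<forall>i. corner L i b \<longrightarrow> Horizontal i \<notin> B) \<longleftrightarrow>
        \<not> ((\<forall>j<b. (0, j) \<in> L) \<and> Horizontal 0 \<in> B)"
      unfolding corner_first_empty_column[OF L] by blast
    ultimately have "A \<in> admissible a (Suc b) L \<longleftrightarrow> B \<in> ?N"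
      unfolding admissible_def mem_Collect_eq sub by blast
    also have "\<dots> \<longleftrightarrow> A \<in> insert (Vertical b) ` ?N"
      using B nv unfolding A by (auto simp: image_iff) (metis insert_ident)+
    finally show ?thesis using True nv by auto
  qed
  then have eq: "admissible a (Suc b) L = admissible a b L \<union> insert (Vertical b) ` ?N"
    by blast
  have "admissible a b L \<inter> insert (Vertical b) ` ?N = {}"
    using nv by blast
  then have "arrow_sum q a (Suc b) L = arrow_sum q a b L +
      (\<Sum>A\<in>insert (Vertical b) ` ?N. \<Prod>x\<in>A. - (q ^ arrow_length a L x))"
    unfolding arrow_sum_def eq by (subst sum.union_disjoint) (auto simp: finite_admissible)
  also have "(\<Sum>A\<in>insert (Vertical b) ` ?N. \<Prod>x\<in>A. - (q ^ arrow_length a L x)) =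
      - (q ^ (a - b)) * (\<Sum>A\<in>?N. \<Prod>x\<in>A. - (q ^ arrow_length a L x))"
    by (subst sum_prod_insert)
      (auto simp: finite_admissible admissible_imp_finite nv arrow_length_Vertical_empty[OF L])
  finally show ?thesis by simp
qed

lemma arrow_sum_Suc_no_corner:
  assumes "L \<in> subdiagrams a b" "\<not> (\<forall>j<b. (0, j) \<in> L)"
  shows "arrow_sum q a (Suc b) L = (1 - q ^ (a - b)) * arrow_sum q a b L"
  using arrow_sum_Suc[OF assms(1), of q] assms(2)
  by (simp add: arrow_sum_def[of q a b] algebra_simps)

text \<open>Let \<open>m = Suc a - b\<close>, the length of both arrows through the corner
  \<open>(0, b)\<close>. The sets avoiding \<open>Horizontal 0\<close> contribute
  \<open>T = arrow_sum q a b L\<close>, so the sum is \<open>S - q ^ m * T\<close> with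
  \<open>S = (1 - q ^ m) * T\<close>. It is rewritten as
  \<open>(1 - q ^ m) * S - q ^ (2 * m) * T\<close>, so that the leading factor agrees with the case
  without a corner and only the forbidden pair remains as a correction.\<close>

lemma arrow_sum_Suc_corner:
  assumes "L \<in> subdiagrams a b" "b \<le> a"
  shows "arrow_sum q (Suc a) (Suc b) (add_row b L) =
    (1 - q ^ (Suc a - b)) * arrow_sum q (Suc a) b (add_row b L)
      - q ^ (2 * (Suc a - b)) * arrow_sum q a b L"
proof -
  have "add_row b L \<in> subdiagrams (Suc a) b"
    using add_row_subdiagrams[OF assms(2)] assms(1) by blast
  from arrow_sum_Suc[OF this, of q]
  have "arrow_sum q (Suc a) (Suc b) (add_row b L) =
      arrow_sum q (Suc a) b (add_row b L) - q ^ (Suc a - b) * arrow_sum q a b L"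
    by (simp add: admissible_add_row_without_top sum_shifted_admissible)
  moreover have "q ^ (2 * (Suc a - b)) = q ^ (Suc a - b) * q ^ (Suc a - b)"
    by (simp only: mult_2 power_add)
  ultimately show ?thesis
    unfolding arrow_sum_add_row
      by (simp only: left_diff_distrib right_diff_distrib mult_1_left mult.assoc) simp
qed

text \<open>The weight \<open>f\<close> stays arbitrary because arrow sums with \<open>b\<close> and
  with \<open>Suc b\<close> columns are both substituted for it.\<close>

lemma sum_add_row:
  fixes q :: "'a::comm_ring_1"
  assumes "b \<le> a"
  shows "(\<Sum>L\<in>{L \<in> subdiagrams (Suc a) b. \<forall>j<b. (0, j) \<in> L}. q ^ (2 * card L) * f L) =
    q ^ (2 * b) * (\<Sum>L\<in>subdiagrams a b. q ^ (2 * card L) * f (add_row b L))"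
  unfolding add_row_subdiagrams[OF assms, symmetric]
  by (subst sum.reindex)
    (auto intro!: sum.cong intro: inj_on_subset[OF inj_add_row]
      simp: sum_distrib_left card_add_row finite_subdiagram distrib_left power_add mult.assoc)

section \<open>The first recurrence for \<open>config_sum\<close>\<close>

lemma config_sum_0_0: "config_sum q 0 0 = 1"
proof -
  have "subdiagrams 0 0 = {{}}" by (auto simp: subdiagrams_def down_closed_def)
  moreover have "admissible 0 0 {} = {{}}" by (auto simp: admissible_def)
  ultimately show ?thesis by (simp add: config_sum_def arrow_sum_def)
qed

text \<open>With no columns, having a full top row is a vacuous condition, so removing a row covers
  all diagrams.\<close>

lemma config_sum_Suc_0: "config_sum q (Suc a) 0 = (1 - q ^ Suc a) * config_sum q a 0"
  using sum_add_row[of 0 a q "arrow_sum q (Suc a) 0"]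
  by (simp add: config_sum_def arrow_sum_add_row sum_distrib_left algebra_simps)

text \<open>Diagrams whose top row reaches column \<open>b\<close> lose that row; the others have
  column \<open>b\<close> empty. Among the latter, exactly those with \<open>b\<close> cells in the
  top row have a corner in column \<open>b\<close> and need the correction term.\<close>

lemma config_sum_Suc_Suc:
  assumes "b \<le> a"
  shows "config_sum q (Suc a) (Suc b) =
    q ^ (2 * Suc b) * (1 - q ^ (a - b)) * config_sum q a (Suc b)
    + (1 - q ^ (Suc a - b)) * config_sum q (Suc a) b - q ^ (2 * Suc a) * config_sum q a b"
proof -
  let ?D = "subdiagrams (Suc a) (Suc b)" and ?full = "\<lambda>b L. \<forall>j<b. (0, j) \<in> L"
  let ?f = "\<lambda>L. q ^ (2 * card L) * arrow_sum q (Suc a) (Suc b) L"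
  \<comment> \<open>If column \<open>b\<close> contains any cell of \<open>L\<close>, downward
    closure fills the top row through column \<open>b\<close>.\<close>
  have rest: "{L \<in> ?D. \<not> ?full (Suc b) L} = subdiagrams (Suc a) b"
  proof (intro equalityI subsetI)
    fix L assume "L \<in> {L \<in> ?D. \<not> ?full (Suc b) L}"
    then have L: "L \<in> ?D" and nfull: "\<not> ?full (Suc b) L" by blast+
    have b: "j < b" if "(i, j) \<in> L" for i j
    proof (rule ccontr)
      assume "\<not> j < b"
      then have "?full (Suc b) L"
        using subdiagrams_downD[OF L that, of 0] by simp
      with nfull show False by blast
    qed
    show "L \<in> subdiagrams (Suc a) b"
      by (rule subdiagramsI) (use subdiagramsD(1)[OF L] b subdiagrams_downD[OF L] in blast)+
  next
    fix L assume L: "L \<in> subdiagrams (Suc a) b"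
    have "(0, b) \<notin> L"
      using subdiagramsD(2)[OF L] by blast
    moreover have "L \<in> ?D"
      by (rule subdiagramsI) (use subdiagramsD[OF L] less_SucI subdiagrams_downD[OF L] in blast)+
    ultimately show "L \<in> {L \<in> ?D. \<not> ?full (Suc b) L}"
      by blast
  qed
  have split: "(\<Sum>L\<in>D. g L) = (\<Sum>L\<in>{L \<in> D. P L}. g L) + (\<Sum>L\<in>{L \<in> D. \<not> P L}. g L)"
    if "finite D" for D P and g :: "cell set \<Rightarrow> 'a"
    using that by (subst sum.union_disjoint[symmetric]) (auto intro: sum.cong)
  have "config_sum q (Suc a) (Suc b) = (\<Sum>L\<in>{L \<in> ?D. ?full (Suc b) L}. ?f L)
    + (\<Sum>L\<in>subdiagrams (Suc a) b. ?f L)"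
    unfolding config_sum_def rest[symmetric] by (rule split) (rule finite_subdiagrams)
  also have "(\<Sum>L\<in>{L \<in> ?D. ?full (Suc b) L}. ?f L)
    = q ^ (2 * Suc b) * (1 - q ^ (a - b)) * config_sum q a (Suc b)"
  proof (cases "Suc b \<le> a")
    case True
    show ?thesis
      unfolding sum_add_row[OF True] arrow_sum_add_row config_sum_def
      by (simp only: sum_distrib_left diff_Suc_Suc mult_ac)
  next
    \<comment> \<open>Here \<open>b = a\<close>: no diagram reaches column \<open>b\<close>, and the
      factor \<open>1 - q ^ (a - b)\<close> is zero, so both sides vanish whatever
      \<open>config_sum q a (Suc b)\<close> is.\<close>
    case False
    have "(0, b) \<notin> L" if "L \<in> ?D" for L
      using subdiagramsD(1)[OF that, of 0 b] False by auto
    then have "{L \<in> ?D. ?full (Suc b) L} = {}" by blast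
    then show ?thesis using False by (simp only: sum.empty) simp
  qed
  also have "(\<Sum>L\<in>subdiagrams (Suc a) b. ?f L) =
      (1 - q ^ (Suc a - b)) * config_sum q (Suc a) b - q ^ (2 * Suc a) * config_sum q a b"
  proof -
    let ?F = "{L \<in> subdiagrams (Suc a) b. ?full b L}" and ?E
      = "{L \<in> subdiagrams (Suc a) b. \<not> ?full b L}"
    let ?g = "\<lambda>L. q ^ (2 * card L) * arrow_sum q (Suc a) b L"
    \<comment> \<open>\<open>2 * b\<close> comes from the cells of the top row and
      \<open>2 * (Suc a - b)\<close> from the two arrows through its corner.\<close>
    have e: "2 * b + 2 * (Suc a - b) = 2 * Suc a"
      using assms by simp
    have "(\<Sum>L\<in>?F. ?f L) = q ^ (2 * b) * (\<Sum>L\<in>subdiagrams a b. q ^ (2 * card L) *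
        ((1 - q ^ (Suc a - b)) * arrow_sum q (Suc a) b (add_row b L)
          - q ^ (2 * (Suc a - b)) * arrow_sum q a b L))"
      unfolding sum_add_row[OF assms]
      by (intro arg_cong[of _ _ "(*) _"] sum.cong refl) (simp only: arrow_sum_Suc_corner[OF _ assms])
    also have "\<dots> = (1 - q ^ (Suc a - b)) * (\<Sum>L\<in>?F. ?g L)
      - q ^ (2 * b + 2 * (Suc a - b)) * config_sum q a b"
      unfolding sum_add_row[OF assms] config_sum_def power_add
      by (simp add: sum_distrib_left sum_subtractf[symmetric] left_diff_distrib right_diff_distrib mult_ac)
    finally have F: "(\<Sum>L\<in>?F. ?f L) = (1 - q ^ (Suc a - b)) * (\<Sum>L\<in>?F. ?g L)
      - q ^ (2 * Suc a) * config_sum q a b"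
      unfolding e .
    have E: "(\<Sum>L\<in>?E. ?f L) = (1 - q ^ (Suc a - b)) * (\<Sum>L\<in>?E. ?g L)"
      unfolding sum_distrib_left
      by (intro sum.cong refl) (simp add: arrow_sum_Suc_no_corner mult_ac)
    have "(\<Sum>L\<in>subdiagrams (Suc a) b. ?f L) = (\<Sum>L\<in>?F. ?f L) + (\<Sum>L\<in>?E. ?f L)"
      by (rule split) (rule finite_subdiagrams)
    moreover have "config_sum q (Suc a) b = (\<Sum>L\<in>?F. ?g L) + (\<Sum>L\<in>?E. ?g L)"
      unfolding config_sum_def by (rule split) (rule finite_subdiagrams)
    ultimately show ?thesis
      unfolding F E by (simp only: distrib_left) (simp add: algebra_simps)
  qed
  finally show ?thesis by (simp add: algebra_simps)
qed

section \<open>Staircase configurations\<close>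

text \<open>For the converse the parts are the row lengths. Their number is the size of column 0,
  which keeps only nonempty rows and so makes all parts positive.\<close>

lemma partition_diagrams_iff: "L \<in> partition_diagrams \<longleftrightarrow> finite L \<and> down_closed L"
proof
  assume "L \<in> partition_diagrams"
  then obtain xs where L: "L = ferrers xs" and xs: "is_partition xs"
    by (auto simp: partition_diagrams_def)
  have "xs ! i \<le> xs ! i'" if "i' \<le> i" "i < length xs" for i i'
    using xs that sorted_wrt_nth_less[of "(\<ge>)" xs i' i]
    by (cases "i' = i") (auto simp: is_partition_def)
  then show "finite L \<and> down_closed L"
    unfolding L using finite_ferrers by (fastforce simp: down_closed_def ferrers_def)
next
  assume L: "finite L \<and> down_closed L"
  define row where "row i = card {j. (i, j) \<in> L}" for i
  have down: "(i', j') \<in> L" if "(i, j) \<in> L" "i' \<le> i" "j' \<le> j" for i j i' j'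
    using L that unfolding down_closed_def by blast
  have "{j. (i, j) \<in> L} \<subseteq> snd ` L" "{i. (i, 0) \<in> L} \<subseteq> fst ` L" for i
    by (auto intro: rev_image_eqI)
  then have fin: "finite {j. (i, j) \<in> L}" "finite {i. (i, 0) \<in> L}" for i
    using L finite_imageI finite_subset by metis+
  \<comment> \<open>A finite initial segment of the natural numbers is determined by its
    cardinality; this is applied both to rows and to column 0.\<close>
  have initial: "x \<in> S \<longleftrightarrow> x < card S" if "finite S" "\<And>x y. x \<in> S \<Longrightarrow> y \<le> x \<Longrightarrow> y \<in> S"
    for S :: "nat set" and x
  proof
    assume "x \<in> S"
    then have "{..x} \<subseteq> S" using that(2) by auto
    from card_mono[OF that(1) this] show "x < card S" by simp
  next
    assume x: "x < card S"
    show "x \<in> S"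
    proof (rule ccontr)
      assume "x \<notin> S"
      then have "S \<subseteq> {..<x}" using that(2) by (metis lessThan_iff not_le_imp_less subsetI)
      from card_mono[OF _ this] x show False by simp
    qed
  qed
  have row: "(i, j) \<in> L \<longleftrightarrow> j < row i" for i j
    using initial[OF fin(1), of i j] down by (auto simp: row_def)
  define n where "n = card {i. (i, 0) \<in> L}"
  have n: "0 < row i \<longleftrightarrow> i < n" for i
    using initial[OF fin(2), of i] down row by (auto simp: n_def)
  have "row i \<le> row i'" if "i' \<le> i" for i i'
    unfolding row_def using down[OF _ that] by (intro card_mono fin(1)) auto
  then have "is_partition (map row [0..<n])"
    using n by (auto simp: is_partition_def sorted_wrt_iff_nth_less)
  moreover have "(i, j) \<in> L \<longleftrightarrow> (i, j) \<in> ferrers (map row [0..<n])" for i j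
    using row[of i j] n[of i] by (auto simp: ferrers_def)
  then have "L = ferrers (map row [0..<n])" by auto
  ultimately show "L \<in> partition_diagrams"
    unfolding partition_diagrams_def by blast
qed

lemma subdiagrams_eq: "subdiagrams k k = {L \<in> partition_diagrams. L \<subseteq> staircase (k - 1)}"
proof -
  have "L \<in> subdiagrams k k \<longleftrightarrow> L \<in> partition_diagrams \<and> L \<subseteq> staircase (k - 1)" for L
  proof
    assume L: "L \<in> subdiagrams k k"
    have "(i, j) \<in> staircase (k - 1)" if "(i, j) \<in> L" for i j
      using subdiagramsD(1)[OF L that] by simp
    moreover have "down_closed L"
      using L by (simp add: subdiagrams_def)
    ultimately show "L \<in> partition_diagrams \<and> L \<subseteq> staircase (k - 1)"
      using finite_subdiagram[OF L] by (simp add: partition_diagrams_iff subrelI)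
  next
    assume L: "L \<in> partition_diagrams \<and> L \<subseteq> staircase (k - 1)"
    have "i + j < k - 1" if "(i, j) \<in> L" for i j
      using L that mem_staircase by blast
    then have "i + j + 1 < k" "j < k" if "(i, j) \<in> L" for i j
      using that by fastforce+
    with L show "L \<in> subdiagrams k k"
      unfolding subdiagrams_def partition_diagrams_iff by blast
  qed
  then show ?thesis by blast
qed

text \<open>The bound \<open>i < k\<close> matters at \<open>k = 0\<close>, where the empty diagram
  has the corner \<open>(0, 0)\<close> but the staircase has no cell.\<close>

lemma outer_corners_iff:
  assumes "L \<in> subdiagrams k k" "i < k"
  shows "(i, j) \<in> outer_corners k L \<longleftrightarrow> corner L i j"
proof
  assume "(i, j) \<in> outer_corners k L"
  then have notin: "(i, j) \<notin> L" and "down_closed (insert (i, j) L)"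
    by (auto simp: outer_corners_def partition_diagrams_iff)
  then have down: "(i', j') \<in> insert (i, j) L" if "i' \<le> i" "j' \<le> j" for i' j'
    using that unfolding down_closed_def by blast
  show "corner L i j"
    unfolding corner_def
  proof (intro conjI allI impI)
    show "(i', j) \<in> L" if "i' < i" for i'
      using down[of i' j] that by simp
    show "(i, j') \<in> L" if "j' < j" for j'
      using down[of i j'] that by simp
  qed (rule notin)
next
  assume c: "corner L i j"
  \<comment> \<open>For \<open>j > 0\<close> the left neighbour lies in \<open>L\<close>, hence in
    the staircase of size \<open>k - 1\<close>, which leaves room for \<open>(i, j)\<close>; for
    \<open>j = 0\<close> the bound on \<open>i\<close> gives the claim.\<close>
  have "i + j < k"
  proof (cases j)
    case (Suc j')
    with c have "(i, j') \<in> L" by (simp add: corner_def)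
    from subdiagramsD(1)[OF assms(1) this] Suc show ?thesis by simp
  qed (use assms in simp)
  moreover have "down_closed (insert (i, j) L)"
    unfolding down_closed_def
  proof (intro allI impI)
    fix x y x' y' assume *: "(x, y) \<in> insert (i, j) L" "x' \<le> x" "y' \<le> y"
    show "(x', y') \<in> insert (i, j) L"
    proof (cases "(x, y) \<in> L")
      case True
      then show ?thesis using subdiagrams_downD[OF assms(1)] * by blast
    next
      case False
      with * have xy: "x' \<le> i" "y' \<le> j" by auto
      show ?thesis
      proof (cases "x' < i")
        case True
        then have "(x', j) \<in> L" using c by (simp add: corner_def)
        then show ?thesis using subdiagrams_downD[OF assms(1)] xy by blast
      next
        case False
        then show ?thesis using xy c by (cases "y' = j") (auto simp: corner_def)
      qed
    qed
  qed
  ultimately show "(i, j) \<in> outer_corners k L"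
    using c finite_subdiagram[OF assms(1)]
    by (auto simp: outer_corners_def partition_diagrams_iff corner_def)
qed

text \<open>The cells with \<open>Suc (i + j) = k\<close> lie outside every \<open>L\<close> in
  \<open>subdiagrams k k\<close>, and each row and column of the staircase has one, so all of them
  can carry arrows.\<close>

lemma arrows_eq:
  assumes "L \<in> subdiagrams k k"
  shows "arrows (staircase k - L) = Horizontal ` {..<k} \<union> Vertical ` {..<k}"
proof -
  have diag: "(i, j) \<in> staircase k - L" if "Suc (i + j) = k" for i j
    using that subdiagramsD(1)[OF assms, of i j] by auto
  have "x \<in> arrows (staircase k - L)" if "x \<in> Horizontal ` {..<k} \<union> Vertical ` {..<k}" for x
  proof (cases x)
    case (Horizontal i)
    with that have "(i, k - 1 - i) \<in> arrow_cells (staircase k - L) x"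
      using diag[of i "k - 1 - i"] by auto
    then show ?thesis by (auto simp: arrows_def)
  next
    case (Vertical j)
    with that have "(k - 1 - j, j) \<in> arrow_cells (staircase k - L) x"
      using diag[of "k - 1 - j" j] by auto
    then show ?thesis by (auto simp: arrows_def)
  qed
  moreover have "x \<in> Horizontal ` {..<k} \<union> Vertical ` {..<k}"
    if "x \<in> arrows (staircase k - L)" for x
    using that by (cases x) (auto simp: arrows_def)
  ultimately show ?thesis by blast
qed

text \<open>Two distinct arrows through \<open>(i, j)\<close> must be \<open>Horizontal i\<close>
  and \<open>Vertical j\<close>, which turns the condition on pairs of arrows into the one in
  \<open>admissible\<close>.\<close>

lemma staircase_configs_eq: "staircase_configs k = Sigma (subdiagrams k k) (admissible k k)"
proof -
  have "A \<subseteq> arrows (staircase k - L) \<and> (\<forall>c \<in> outer_corners k L. \<forall>a \<in> A. \<forall>b \<in> A.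
      c \<in> arrow_cells (staircase k - L) a \<and> c \<in> arrow_cells (staircase k - L) b \<longrightarrow> a = b) \<longleftrightarrow>
      A \<in> admissible k k L" (is "?sub \<and> ?P \<longleftrightarrow> _") if L: "L \<in> subdiagrams k k" for L A
  proof -
    have "?P \<longleftrightarrow> (\<forall>i j. corner L i j \<longrightarrow> \<not> (Horizontal i \<in> A \<and> Vertical j \<in> A))" (is "_ \<longleftrightarrow> ?Q") if ?sub
    proof
      assume P: ?P
      show ?Q
      proof (intro allI impI notI)
        fix i j assume c: "corner L i j" and HV: "Horizontal i \<in> A \<and> Vertical j \<in> A"
        then have "i < k" using \<open>?sub\<close> by (auto simp: arrows_eq[OF L])
        with c have o: "(i, j) \<in> outer_corners k L" by (simp add: outer_corners_iff[OF L])
        then have "(i, j) \<in> staircase k - L" by (simp add: outer_corners_def)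
        with P o HV have "Horizontal i = Vertical j" by force
        then show False by simp
      qed
    next
      assume Q: ?Q
      show ?P
      proof (intro ballI impI)
        fix c x y assume c: "c \<in> outer_corners k L" and x: "x \<in> A" and y: "y \<in> A"
          and cells: "c \<in> arrow_cells (staircase k - L) x \<and> c \<in> arrow_cells (staircase k - L) y"
        obtain i j where ij: "c = (i, j)" by (cases c)
        have "i < k" using c by (auto simp: ij outer_corners_def)
        then have "corner L i j" using c outer_corners_iff[OF L] by (simp add: ij)
        with Q have "\<not> (Horizontal i \<in> A \<and> Vertical j \<in> A)" by blast
        with cells x y show "x = y" unfolding ij by (cases x; cases y) auto
      qed
    qed
    then show ?thesis by (auto simp: admissible_def arrows_eq[OF L])
  qed
  then show ?thesis
    unfolding staircase_configs_def subdiagrams_eq by blast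
qed

lemma wt_eq:
  assumes "finite A"
  shows "wt k q (L, A) = q ^ (2 * card L) * (\<Prod>x\<in>A. - (q ^ arrow_length k L x))"
proof -
  have "(\<Prod>x\<in>A. - (q ^ arrow_length k L x)) = (\<Prod>x\<in>A. (- 1) * q ^ arrow_length k L x)"
    by simp
  also have "\<dots> = (- 1) ^ card A * q ^ total_length (staircase k - L) A"
    by (simp only: prod.distrib prod_constant power_sum total_length_def arrow_length_def)
  finally show ?thesis by (simp add: power_add mult_ac)
qed

lemma sum_wt_eq_config_sum: "(\<Sum>C\<in>staircase_configs k. wt k q C) = config_sum q k k"
proof -
  have "(\<Sum>C\<in>staircase_configs k. wt k q C)
    = (\<Sum>L\<in>subdiagrams k k. \<Sum>A\<in>admissible k k L. wt k q (L, A))"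
    unfolding staircase_configs_eq
    by (subst sum.Sigma) (auto simp: finite_subdiagrams finite_admissible simp del: wt.simps)
  also have "\<dots> = config_sum q k k"
    unfolding config_sum_def arrow_sum_def sum_distrib_left
    by (intro sum.cong refl) (simp add: wt_eq admissible_imp_finite del: wt.simps)
  finally show ?thesis .
qed

section \<open>Evaluation on the diagonal\<close>

lemma config_sum_diagonal:
  "config_sum q (Suc k) (Suc k) = config_sum q k k + 2 * (- q) ^ (Suc k) ^ 2"
proof -
  \<comment> \<open>\<open>h\<close> is the excess of rows over columns, so exponents need no
    subtraction and only sums with \<open>b \<le> a\<close> occur.\<close>
  define Z where "Z h b = config_sum q (b + h) b" for h b
  have "Z 0 (Suc k) = Z 0 k + 2 * (- q) ^ (Suc k) ^ 2"
  proof (rule diagonal_recurrence)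
    show "Z 0 0 = 1"
      by (simp add: Z_def config_sum_0_0)
    show "Z (Suc h) 0 = (1 - q ^ Suc h) * Z h 0" for h
      by (simp add: Z_def config_sum_Suc_0)
    \<comment> \<open>With \<open>a = b\<close> the factor \<open>1 - q ^ (a - b)\<close> is zero,
      which removes \<open>config_sum q b (Suc b)\<close>, the one term not of the form
      \<open>Z h b\<close>.\<close>
    show "Z 0 (Suc b) = (1 - q) * Z 1 b - q ^ (2 * Suc b) * Z 0 b" for b
      using config_sum_Suc_Suc[of b b q] by (simp add: Z_def)
    show "Z (Suc h) (Suc b) =
        q ^ (2 * Suc b) * (1 - q ^ Suc h) * Z h (Suc b) + (1 - q ^ (h + 2)) * Z (h + 2) b
        - q ^ (2 * (b + h + 2)) * Z (Suc h) b" for h b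
    proof -
      have "Suc (b + Suc h) - b = h + 2" by simp
      then show ?thesis
        using config_sum_Suc_Suc[of b "b + Suc h" q] by (simp add: Z_def)
    qed
  qed
  then show ?thesis
    by (simp add: Z_def)
qed

text \<open>The increment in \<open>config_sum_diagonal\<close> is the contribution of the two new
  indices \<open>Suc k\<close> and \<open>- Suc k\<close>, whose squares agree.\<close>

lemma config_sum_eq_theta: "config_sum q k k = (\<Sum>i\<in>{- int k..int k}. (- q) ^ nat (i ^ 2))"
proof (induction k)
  case 0
  show ?case by (simp add: config_sum_0_0)
next
  case (Suc k)
  have range: "{- int (Suc k)..int (Suc k)}
    = insert (- int (Suc k)) (insert (int (Suc k)) {- int k..int k})"
    by auto
  have fresh: "- int (Suc k) \<notin> insert (int (Suc k)) {- int k..int k}" "int (Suc k) \<notin> {- int k..int k}"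
    by auto
  have square: "nat (int (Suc k) ^ 2) = (Suc k) ^ 2"
    by (metis nat_int of_nat_power)
  have "(\<Sum>i\<in>{- int (Suc k)..int (Suc k)}. (- q) ^ nat (i ^ 2)) =
      (- q) ^ (Suc k) ^ 2 + ((- q) ^ (Suc k) ^ 2 + (\<Sum>i\<in>{- int k..int k}. (- q) ^ nat (i ^ 2)))"
    unfolding range sum.insert[OF finite.insertI[OF finite_atLeastAtMost_int] fresh(1)]
      sum.insert[OF finite_atLeastAtMost_int fresh(2)] power2_minus square ..
  then show ?case
    by (simp only: config_sum_diagonal Suc mult_2 add_ac)
qed

theorem theorem3p3:
  fixes k :: nat and q :: "'a::comm_ring_1"
  shows "(\<Sum>C\<in>staircase_configs k. wt k q C) = (\<Sum>i\<in>{- int k..int k}. (- q) ^ nat (i ^ 2))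
    \<and> (k \<ge> 1 \<longrightarrow>
         (\<Sum>C\<in>staircase_configs k. wt k q C) =
         (\<Sum>C\<in>staircase_configs (k - 1). wt (k - 1) q C) + 2 * (- q) ^ (k ^ 2))"
proof -
  have "config_sum q k k = config_sum q (k - 1) (k - 1) + 2 * (- q) ^ (k ^ 2)" if "k \<ge> 1"
    using that config_sum_diagonal[of q "k - 1"] by simp
  then show ?thesis
    unfolding sum_wt_eq_config_sum using config_sum_eq_theta by blast
qed

end
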